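(* Let $n\ge2$ be a natural number. The closed unit ball $\mathbb D^3\subseteq\mathbb R^3$ is $(n,3n-1)$-paradoxical with respect to the action of $\mathrm{SE}(3)$ on $\mathbb R^3$.
   Context: $\mathrm{SE}(3)$ is the group of direct isometries of $\mathbb R^3$, i.e. maps $\mathbf x\mapsto\rho(\mathbf x)+\mathbf b$ with $\rho\in\mathrm{SO}(3)$ and $\mathbf b\in\mathbb R^3$, acting on $\mathbb R^3$ by evaluation. For $\gamma\in\mathrm{SE}(3)$ and $E\subseteq\mathbb R^3$, $\gamma(E)$ is the image of $E$. For $E,F\subseteq\mathbb R^3$ and $r\in\mathbb N$, write $E\sim_r F$ if there are a partition $E=E_0\sqcup\dots\sqcup E_{r-1}$ and $\gamma_0,\dots,\gamma_{r-1}\in\mathrm{SE}(3)$ with $F=\gamma_0(E_0)\sqcup\dots\sqcup\gamma_{r-1}(E_{r-1})$ (a disjoint union). A set $E$ is $(n,k)$-paradoxical if there is a partition $E=P_0\sqcup\dots\sqcup P_{n-1}$ and natural numbers $k_0,\dots,k_{n-1}$ with $P_j\sim_{k_j}E$ for all $j<n$ and $k_0+\dots+k_{n-1}=k$. The axiom of choice is assumed. *)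

theory Defs
  imports "HOL-Analysis.Analysis"
begin

definition SE3 :: "(real^3 \<Rightarrow> real^3) set" where
  "SE3 = {\<gamma>. \<exists>R b. rotation_matrix R \<and> \<gamma> = (\<lambda>x. R *v x + b)}"

text \<open>
  \<open>disjoint_union_of r E A\<close>: the set \<open>A\<close> is the disjoint union of the indexed family
  \<open>E 0, \<dots>, E (r - 1)\<close>. Members of the family may be empty; only indices below \<open>r\<close> matter.
\<close>
definition disjoint_union_of :: "nat \<Rightarrow> (nat \<Rightarrow> 'a set) \<Rightarrow> 'a set \<Rightarrow> bool" where
  "disjoint_union_of r E A \<longleftrightarrow> disjoint_family_on E {..<r} \<and> (\<Union>i<r. E i) = A"

definition equidecomposable :: "nat \<Rightarrow> (real^3) set \<Rightarrow> (real^3) set \<Rightarrow> bool" where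
  "equidecomposable r A B \<longleftrightarrow>
     (\<exists>E \<gamma>. disjoint_union_of r E A \<and> (\<forall>i<r. \<gamma> i \<in> SE3) \<and>
            disjoint_union_of r (\<lambda>i. \<gamma> i ` E i) B)"

definition paradoxical :: "nat \<Rightarrow> nat \<Rightarrow> (real^3) set \<Rightarrow> bool" where
  "paradoxical n k A \<longleftrightarrow>
     (\<exists>P (\<kappa> :: nat \<Rightarrow> nat). disjoint_union_of n P A \<and>
            (\<forall>j<n. equidecomposable (\<kappa> j) (P j) A) \<and> (\<Sum>j<n. \<kappa> j) = k)"

end

theory Submission
  imports Defs "HOL-Analysis.Cross3"
begin

text \<open>
  Let \<open>a\<close>, \<open>b\<close> be the rotations by \<open>arccos (3/5)\<close> about two coordinate axes; they generate a free
  group \<open>G\<close>. Attach to every point \<open>x \<noteq> 0\<close> an end (an infinite reduced word) of \<open>G\<close>, in a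
  \<open>G\<close>-equivariant way, except on the orbit of one point \<open>p\<close> with trivial stabilizer, where \<open>M p\<close>
  receives the finite word \<open>M\<close>. On an orbit with nontrivial stabilizers this works since the
  stabilizer of a point, being a group of rotations about one axis, is commutative, so that it
  fixes the end \<open>w w w \<dots>\<close> of any of its elements \<open>w\<close>.

  Write \<open>K l\<close> for the points \<open>x \<noteq> 0\<close> of the ball whose word starts with \<open>l\<close>. The four sets \<open>K l\<close>
  and \<open>{p}\<close> partition the punctured ball \<open>D\<close>, and \<open>D = K l \<squnion> l (K (inverse l))\<close>. Hence
  \<open>Q = K a \<squnion> K (inverse a) \<squnion> {p}\<close> is equidecomposable with the ball using three pieces, the third
  one being \<open>p\<close>, which is translated to the centre. Moreover \<open>C = D - K (inverse b)\<close> satisfies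
  \<open>b C = K b = C - Q\<close>, so \<open>C = Q \<squnion> b Q \<squnion> \<dots> \<squnion> b^(m-1) Q \<squnion> b^m C\<close>, and
  \<open>b^m C \<squnion> K (inverse b) \<squnion> {0}\<close> is equidecomposable with the ball using two pieces.
  Take \<open>m = n - 1\<close>.
\<close>

section \<open>A free group of rotations\<close>

lemma rotation_matrix_mult:
  fixes A B :: "real^'n^'n"
  shows "rotation_matrix A \<Longrightarrow> rotation_matrix B \<Longrightarrow> rotation_matrix (A ** B)"
  by (auto simp: rotation_matrix_def det_mul intro: orthogonal_matrix_mul)

lemma rotation_matrix_mat_1: "rotation_matrix (mat 1 :: real^'n^'n)"
  by (simp add: rotation_matrix_def orthogonal_matrix_id)

type_synonym letter = "bool \<times> bool"

fun inv_letter :: "letter \<Rightarrow> letter" where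
  "inv_letter (g, s) = (g, \<not> s)"

lemma inv_letter_inv [simp]: "inv_letter (inv_letter l) = l"
  by (cases l) auto

lemma inv_letter_neq [simp]: "inv_letter l \<noteq> l" "l \<noteq> inv_letter l"
  by (cases l; auto)+

fun gen :: "letter \<Rightarrow> real^3^3" where
  "gen (False, s) = vector [vector [3/5, if s then -4/5 else 4/5, 0],
     vector [if s then 4/5 else -4/5, 3/5, 0], vector [0, 0, 1]]"
| "gen (True, s) = vector [vector [1, 0, 0], vector [0, 3/5, if s then -4/5 else 4/5],
     vector [0, if s then 4/5 else -4/5, 3/5]]"

lemma gen_inv [simp]: "gen (inv_letter l) ** gen l = mat 1" "gen l ** gen (inv_letter l) = mat 1"
  by (cases l rule: inv_letter.cases; cases "fst l"; cases "snd l";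
      simp add: matrix_matrix_mult_def mat_def vec_eq_iff forall_3 sum_3)+

lemma rotation_gen: "rotation_matrix (gen l)"
proof -
  have "transpose (gen l) = gen (inv_letter l)" "det (gen l) = 1"
    by (cases l rule: inv_letter.cases; cases "fst l"; cases "snd l";
      simp add: transpose_def vec_eq_iff forall_3 det_3)+
  then show ?thesis by (simp add: rotation_matrix_def orthogonal_matrix_def)
qed

fun ev :: "letter list \<Rightarrow> real^3^3" where
  "ev [] = mat 1"
| "ev (l # w) = gen l ** ev w"

abbreviation reduced_word :: "letter list \<Rightarrow> bool" where
  "reduced_word \<equiv> successively (\<lambda>l m. m \<noteq> inv_letter l)"

lemma ev_append: "ev (v @ w) = ev v ** ev w"
  by (induction v) (auto simp: matrix_mul_assoc)

lemma rotation_ev: "rotation_matrix (ev w)"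
  by (induction w) (simp_all add: rotation_matrix_mult rotation_gen rotation_matrix_mat_1)

text \<open>Modulo 5, the integer matrix \<open>5 \<cdot> gen l\<close> has rank one. Its image is the line described by
  \<open>residue_class (Some l)\<close>, on which only \<open>5 \<cdot> gen (inv_letter l)\<close> vanishes.\<close>

fun residue_class :: "letter option \<Rightarrow> int \<Rightarrow> int \<Rightarrow> int \<Rightarrow> bool" where
  "residue_class None x y z \<longleftrightarrow> x = 0 \<and> y = 1 \<and> z = 0"
| "residue_class (Some (False, s)) x y z \<longleftrightarrow>
     \<not> 5 dvd x \<and> 5 dvd (if s then y - 3 * x else y - 2 * x) \<and> 5 dvd z"
| "residue_class (Some (True, s)) x y z \<longleftrightarrow>
     5 dvd x \<and> \<not> 5 dvd y \<and> 5 dvd (if s then z - 3 * y else z - 2 * y)"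

definition hd_opt :: "'a list \<Rightarrow> 'a option" where
  "hd_opt w = (case w of [] \<Rightarrow> None | l # _ \<Rightarrow> Some l)"

lemma hd_opt_simps [simp]: "hd_opt [] = None" "hd_opt (l # w) = Some l"
  by (auto simp: hd_opt_def)

lemma reduced_Cons: "reduced_word (l # w) \<longleftrightarrow> reduced_word w \<and> hd_opt w \<noteq> Some (inv_letter l)"
  by (cases w) (auto simp: successively_Cons)

text \<open>No \<open>5 * gen l\<close> kills \<open>vector [0, 1, 0]\<close> modulo 5. Afterwards
  the vector lies on the line of the letter applied most recently, which only the inverse letter
  kills, and a reduced word does not apply that one next.\<close>

lemma residue_class_ev:
  assumes "reduced_word w"
  shows "\<exists>x y z :: int. 5 ^ length w *\<^sub>R (ev w *v vector [0, 1, 0]) =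
     vector [of_int x, of_int y, of_int z] \<and> residue_class (hd_opt w) x y z"
  using assms
proof (induction w)
  case Nil
  show ?case by (intro exI[of _ 0] exI[of _ 1]) simp
next
  case (Cons l w)
  then obtain x y z :: int where e: "5 ^ length w *\<^sub>R (ev w *v vector [0, 1, 0]) =
     vector [of_int x, of_int y, of_int z]" and r: "residue_class (hd_opt w) x y z"
    by (auto simp: reduced_Cons)
  have "5 ^ length (l # w) *\<^sub>R (ev (l # w) *v vector [0, 1, 0]) =
      5 *\<^sub>R (gen l *v (5 ^ length w *\<^sub>R (ev w *v vector [0, 1, 0])))"
    by (simp add: matrix_vector_mult_scaleR matrix_vector_mul_assoc)
  then have e': "5 ^ length (l # w) *\<^sub>R (ev (l # w) *v vector [0, 1, 0]) =
      5 *\<^sub>R (gen l *v vector [of_int x, of_int y, of_int z])"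
    unfolding e .
  obtain g s where l: "l = (g, s)" by (cases l)
  \<comment> \<open>\<open>t\<close> is five times the sine of the angle of \<open>gen l\<close>, so
    \<open>X\<close>, \<open>Y\<close>, \<open>Z\<close> are the coordinates after applying
    \<open>5 * gen l\<close>.\<close>
  define t :: int where "t = (if s then 4 else -4)"
  have m: "hd_opt w \<noteq> Some (inv_letter l)" using Cons by (simp add: reduced_Cons)
  define X Y Z where "X = (if g then 5 * x else 3 * x - t * y)"
    and "Y = (if g then 3 * y - t * z else t * x + 3 * y)"
    and "Z = (if g then t * y + 3 * z else 5 * z)"
  have "5 *\<^sub>R (gen l *v vector [of_int x, of_int y, of_int z]) = vector [of_int X, of_int Y, of_int Z]"
    by (cases g; cases s; simp add: l X_def Y_def Z_def t_def matrix_vector_mult_def vec_eq_iff forall_3 sum_3)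
  moreover have "residue_class (hd_opt (l # w)) X Y Z"
  proof (cases "hd_opt w")
    case None
    then show ?thesis using r by (cases g; cases s; simp add: l X_def Y_def Z_def t_def)
  next
    case (Some k)
    obtain h u where k: "k = (h, u)" by (cases k)
    show ?thesis using r m
      by (cases g; cases s; cases h; cases u; simp add: Some k l X_def Y_def Z_def t_def; presburger)
  qed
  ultimately show ?case using e' by metis
qed

text \<open>If the lengths differed, the integer vector of the longer word would vanish modulo 5,
  which its residue class forbids. At equal lengths the two integer vectors coincide, and the
  classes of different letters exclude each other.\<close>

lemma reduced_eqD:
  assumes "reduced_word v" "reduced_word w" "ev v = ev w"
  shows "length v = length w \<and> hd_opt v = hd_opt w"
proof -
  have le: "length w \<le> length v" if vw: "reduced_word v" "reduced_word w" "ev v = ev w" for v w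
  proof (rule ccontr)
    assume "\<not> length w \<le> length v"
    then obtain d where d: "length w = length v + Suc d"
      by (metis add_Suc_right less_iff_Suc_add not_le)
    obtain x y z :: int where e: "5 ^ length v *\<^sub>R (ev v *v vector [0, 1, 0]) =
        vector [of_int x, of_int y, of_int z]"
      using residue_class_ev[OF vw(1)] by blast
    obtain X Y Z :: int where E: "5 ^ length w *\<^sub>R (ev w *v vector [0, 1, 0]) =
        vector [of_int X, of_int Y, of_int Z]" and r: "residue_class (hd_opt w) X Y Z"
      using residue_class_ev[OF vw(2)] by blast
    have "5 ^ length w *\<^sub>R (ev w *v vector [0, 1, 0]) =
        5 ^ Suc d *\<^sub>R (5 ^ length v *\<^sub>R (ev v *v vector [0, 1, 0]))"
      using vw(3) by (simp add: d power_add)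
    then have "vector [of_int X, of_int Y, of_int Z] =
        5 ^ Suc d *\<^sub>R (vector [of_int x, of_int y, of_int z] :: real^3)"
      unfolding e E .
    then have "real_of_int X = of_int (5 ^ Suc d * x)" "real_of_int Y = of_int (5 ^ Suc d * y)"
        "real_of_int Z = of_int (5 ^ Suc d * z)"
      by (simp_all add: vec_eq_iff forall_3)
    then have "X = 5 ^ Suc d * x" "Y = 5 ^ Suc d * y" "Z = 5 ^ Suc d * z"
      unfolding of_int_eq_iff by auto
    then have "5 dvd X" "5 dvd Y" "5 dvd Z" by auto
    moreover have "w \<noteq> []" using d by auto
    ultimately show False using r
      by (cases "hd_opt w" rule: option.exhaust; cases "the (hd_opt w)"; cases "fst (the (hd_opt w))")
         (auto split: list.splits)
  qed
  have len: "length v = length w" using le assms by (metis antisym)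
  obtain x y z :: int where e: "5 ^ length v *\<^sub>R (ev v *v vector [0, 1, 0]) =
      vector [of_int x, of_int y, of_int z]" and r: "residue_class (hd_opt v) x y z"
    using residue_class_ev[OF assms(1)] by blast
  obtain X Y Z :: int where E: "5 ^ length w *\<^sub>R (ev w *v vector [0, 1, 0]) =
      vector [of_int X, of_int Y, of_int Z]" and R: "residue_class (hd_opt w) X Y Z"
    using residue_class_ev[OF assms(2)] by blast
  have "X = x" "Y = y" "Z = z" using e E len assms(3) by (simp_all add: vec_eq_iff forall_3)
  then have R: "residue_class (hd_opt w) x y z" using R by simp
  have "hd_opt v = hd_opt w"
  proof (cases v)
    case Nil
    then show ?thesis using len by simp
  next
    case (Cons l v')
    then obtain m w' where w: "w = m # w'" using len by (cases w) auto
    obtain g s h u where "l = (g, s)" "m = (h, u)" by (cases l; cases m) auto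
    then show ?thesis using r R unfolding Cons w
      by (cases g; cases s; cases h; cases u; simp; presburger)
  qed
  with len show ?thesis ..
qed

section \<open>First letters and lengths of group elements\<close>

definition rot_group :: "(real^3^3) set" where
  "rot_group = range ev"

lemma rot_group_ev [simp]: "ev w \<in> rot_group"
  by (simp add: rot_group_def)

lemma rot_group_gen [simp]: "gen l \<in> rot_group"
  using rot_group_ev[of "[l]"] by simp

lemma rot_group_mult: "M \<in> rot_group \<Longrightarrow> N \<in> rot_group \<Longrightarrow> M ** N \<in> rot_group"
  unfolding rot_group_def by (auto simp flip: ev_append)

lemma rot_group_inverse:
  assumes "M \<in> rot_group"
  obtains N where "N \<in> rot_group" "N ** M = mat 1" "M ** N = mat 1"
proof -
  have "\<exists>v. ev v ** ev w = mat 1 \<and> ev w ** ev v = mat 1" for w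
  proof (induction w)
    case Nil
    show ?case by (intro exI[of _ "[]"]) simp
  next
    case (Cons l w)
    then obtain v where v: "ev v ** ev w = mat 1" "ev w ** ev v = mat 1" by blast
    have "ev (v @ [inv_letter l]) ** ev (l # w) = ev v ** (gen (inv_letter l) ** gen l) ** ev w"
      by (simp add: ev_append matrix_mul_assoc del: gen_inv)
    moreover have "ev (l # w) ** ev (v @ [inv_letter l]) = gen l ** (ev w ** ev v) ** gen (inv_letter l)"
      by (simp add: ev_append matrix_mul_assoc)
    ultimately show ?case using v by (metis gen_inv matrix_mul_rid)
  qed
  then show thesis using assms that unfolding rot_group_def by (metis imageE rangeI)
qed

section \<open>Cancellation at either end of a reduced word\<close>

lemma reduced_Cons_or_cancel:
  assumes "reduced_word w"
  shows "reduced_word (l # w) \<or> (\<exists>v. w = inv_letter l # v \<and> ev (l # w) = ev v \<and> reduced_word v)"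
proof (cases "hd_opt w = Some (inv_letter l)")
  case True
  then obtain v where v: "w = inv_letter l # v" by (cases w) auto
  then have "ev (l # w) = ev v" by (simp add: matrix_mul_assoc)
  then show ?thesis using assms v by (auto simp: reduced_Cons)
qed (use assms in \<open>simp add: reduced_Cons\<close>)

lemma reduced_snoc_or_cancel:
  assumes "reduced_word w"
  shows "reduced_word (w @ [l]) \<or> (\<exists>v. w = v @ [inv_letter l] \<and> ev (w @ [l]) = ev v \<and> reduced_word v)"
proof (cases "w \<noteq> [] \<and> last w = inv_letter l")
  case True
  then obtain v where v: "w = v @ [inv_letter l]" by (metis append_butlast_last_id)
  then have "ev (w @ [l]) = ev v" by (simp add: ev_append flip: matrix_mul_assoc)
  then show ?thesis using assms v by (auto simp: successively_append_iff)
next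
  case False
  then show ?thesis using assms by (auto simp: successively_append_iff)
qed

lemma rot_group_reduced:
  assumes "M \<in> rot_group"
  obtains w where "reduced_word w" "ev w = M"
proof -
  have "\<exists>v. reduced_word v \<and> ev v = ev w" for w
  proof (induction w)
    case Nil
    show ?case by (intro exI[of _ "[]"]) simp
  next
    case (Cons l w)
    then obtain v where "reduced_word v" "ev v = ev w" by blast
    then show ?case using reduced_Cons_or_cancel[of v l] by (metis ev.simps(2))
  qed
  then show thesis using assms that unfolding rot_group_def by blast
qed

text \<open>Any reduced word for \<open>M\<close> will do: by \<open>reduced_eqD\<close> its length
  and first letter depend on \<open>M\<close> alone, so \<open>len\<close> and \<open>first\<close>
  are well defined on \<open>rot_group\<close>.\<close>

definition word_of :: "real^3^3 \<Rightarrow> letter list" where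
  "word_of M = (SOME w. reduced_word w \<and> ev w = M)"

definition len :: "real^3^3 \<Rightarrow> nat" where
  "len M = length (word_of M)"

definition first :: "real^3^3 \<Rightarrow> letter option" where
  "first M = hd_opt (word_of M)"

lemma len_first_ev:
  assumes "reduced_word w"
  shows "len (ev w) = length w" "first (ev w) = hd_opt w"
proof -
  have "reduced_word (word_of (ev w)) \<and> ev (word_of (ev w)) = ev w"
    unfolding word_of_def by (rule someI[of _ w]) (simp add: assms)
  then have "length (word_of (ev w)) = length w \<and> hd_opt (word_of (ev w)) = hd_opt w"
    using reduced_eqD assms by blast
  then show "len (ev w) = length w" "first (ev w) = hd_opt w"
    by (simp_all add: len_def first_def)
qed

text \<open>Either \<open>l\<close> is prepended without cancellation, or it cancels an initial
  \<open>inv_letter l\<close>; what remains then cannot start with \<open>l\<close>, as the word was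
  reduced. \<open>equivariant_colouring\<close> carries this rule over to points.\<close>

lemma first_gen_mult:
  assumes "M \<in> rot_group"
  shows "first (gen l ** M) = Some l \<longleftrightarrow> first M \<noteq> Some (inv_letter l)"
proof -
  obtain w where w: "reduced_word w" "ev w = M" using rot_group_reduced[OF assms] .
  consider "reduced_word (l # w)" | v where "w = inv_letter l # v" "ev (l # w) = ev v" "reduced_word v"
    using reduced_Cons_or_cancel[OF w(1)] by blast
  then show ?thesis
  proof cases
    case 1
    then show ?thesis using len_first_ev(2)[OF 1] len_first_ev(2)[OF w(1)] w
      by (simp add: reduced_Cons)
  next
    case 2
    then show ?thesis using len_first_ev(2)[OF 2(3)] len_first_ev(2)[OF w(1)] w
      by (auto simp: reduced_Cons)
  qed
qed

lemma len_gen_mult: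
  assumes "M \<in> rot_group"
  shows "len M \<le> len (gen l ** M) + 1"
proof -
  obtain w where w: "reduced_word w" "ev w = M" using rot_group_reduced[OF assms] .
  then show ?thesis
    using reduced_Cons_or_cancel[OF w(1), of l] by (auto simp: len_first_ev dest!: len_first_ev(1))
qed

lemma len_ev_mult:
  assumes "M \<in> rot_group"
  shows "len M \<le> len (ev v ** M) + length v"
proof (induction v)
  case (Cons l v)
  have "len (ev v ** M) \<le> len (gen l ** (ev v ** M)) + 1"
    by (intro len_gen_mult rot_group_mult assms) simp
  with Cons show ?case by (simp add: matrix_mul_assoc)
qed simp

text \<open>A letter multiplied on the right changes only the end of the reduced word; with two
  letters present the first one survives.\<close>

lemma mult_gen:
  assumes "M \<in> rot_group" "len M \<ge> 2"
  shows "first (M ** gen l) = first M" "len M \<le> len (M ** gen l) + 1"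
proof -
  obtain w where w: "reduced_word w" "ev w = M" using rot_group_reduced[OF assms(1)] .
  then have len: "length w \<ge> 2" using assms(2) len_first_ev(1) by metis
  have e: "M ** gen l = ev (w @ [l])" using w by (simp add: ev_append)
  consider "reduced_word (w @ [l])" | v where "w = v @ [inv_letter l]" "ev (w @ [l]) = ev v" "reduced_word v"
    using reduced_snoc_or_cancel[OF w(1)] by blast
  then have "first (M ** gen l) = first M \<and> len M \<le> len (M ** gen l) + 1"
  proof cases
    case 1
    show ?thesis using len_first_ev[OF 1] len_first_ev[OF w(1)] w(2) len
      by (cases w) (simp_all add: e)
  next
    case 2
    have "first (M ** gen l) = hd_opt v" "len (M ** gen l) = length v"
      unfolding e 2(2) by (simp_all add: len_first_ev 2(3))
    moreover have "first M = hd_opt w" "len M = length w"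
      using len_first_ev[OF w(1)] unfolding w(2) by simp_all
    ultimately show ?thesis using len 2(1) by (cases v) simp_all
  qed
  then show "first (M ** gen l) = first M" "len M \<le> len (M ** gen l) + 1" by auto
qed

text \<open>Each letter of \<open>s\<close> shortens the product by at most one, so the length is
  still at least 2 whenever a letter is multiplied on.\<close>

lemma first_mult_ev:
  assumes "M \<in> rot_group" "len M > length s"
  shows "first (M ** ev s) = first M"
  using assms
proof (induction s arbitrary: M)
  case (Cons l s)
  have "first ((M ** gen l) ** ev s) = first (M ** gen l)"
    using Cons.prems mult_gen(2)[of M l] by (intro Cons.IH rot_group_mult) auto
  then show ?case using mult_gen(1)[of M l] Cons.prems by (simp add: matrix_mul_assoc)
qed simp

section \<open>Powers of a cyclically reduced word and the ends they converge to\<close>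

definition word_power :: "letter list \<Rightarrow> nat \<Rightarrow> letter list" where
  "word_power w N = concat (replicate N w)"

lemma ev_word_power_Suc: "ev (word_power w (Suc N)) = ev (word_power w N) ** ev w"
  by (simp add: word_power_def ev_append flip: replicate_append_same)

lemma length_word_power: "length (word_power w N) = N * length w"
  by (induction N) (auto simp: word_power_def)

text \<open>The condition on \<open>hd w\<close> and \<open>last w\<close> makes \<open>w\<close>
  cyclically reduced: nothing cancels where two copies meet.\<close>

lemma reduced_word_power:
  assumes "reduced_word w" "w \<noteq> []" "hd w \<noteq> inv_letter (last w)"
  shows "reduced_word (word_power w N)"
proof (induction N)
  case (Suc N)
  have "hd (word_power w N) = hd w" if "word_power w N \<noteq> []"
    using that assms(2) by (cases N) (auto simp: word_power_def)
  with Suc assms show ?case by (auto simp: word_power_def successively_append_iff)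
qed (simp add: word_power_def)

text \<open>The power has length at least \<open>N\<close>, and the fixed factor \<open>M\<close>
  can cancel no more letters than a word for \<open>M\<close> has.\<close>

lemma len_mult_word_power:
  assumes "reduced_word w" "w \<noteq> []" "hd w \<noteq> inv_letter (last w)" "M \<in> rot_group"
  shows "eventually (\<lambda>N. len (M ** ev (word_power w N)) > K) sequentially"
proof -
  obtain v where v: "M = ev v" using assms(4) by (auto simp: rot_group_def)
  have "len (M ** ev (word_power w N)) > K" if "N \<ge> K + length v + 1" for N
  proof -
    have "N \<le> N * length w" using assms(2) by (cases w) auto
    also have "\<dots> = len (ev (word_power w N))"
      using reduced_word_power[OF assms(1-3)] by (simp add: len_first_ev length_word_power)
    also have "\<dots> \<le> len (M ** ev (word_power w N)) + length v"
      unfolding v by (rule len_ev_mult) simp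
    finally show ?thesis using that by simp
  qed
  then show ?thesis unfolding eventually_sequentially by blast
qed

text \<open>Once the product is longer than \<open>w\<close>, a further factor \<open>ev w\<close>
  on the right cannot reach its first letter.\<close>

lemma first_mult_word_power_eventually_const:
  assumes "reduced_word w" "w \<noteq> []" "hd w \<noteq> inv_letter (last w)" "M \<in> rot_group"
  shows "\<exists>l. eventually (\<lambda>N. first (M ** ev (word_power w N)) = Some l) sequentially"
proof -
  obtain N0 where N0: "\<And>N. N \<ge> N0 \<Longrightarrow> len (M ** ev (word_power w N)) > length w"
    using len_mult_word_power[OF assms] unfolding eventually_sequentially by blast
  have G: "M ** ev (word_power w N) \<in> rot_group" for N
    using assms(4) by (simp add: rot_group_mult)
  have const: "first (M ** ev (word_power w (N0 + k))) = first (M ** ev (word_power w N0))" for k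
  proof (induction k)
    case (Suc k)
    have "first (M ** ev (word_power w (N0 + k)) ** ev w) = first (M ** ev (word_power w (N0 + k)))"
      by (rule first_mult_ev) (use G N0 in auto)
    with Suc show ?case by (simp add: ev_word_power_Suc matrix_mul_assoc)
  qed simp
  obtain v where v: "reduced_word v" "ev v = M ** ev (word_power w N0)" using rot_group_reduced[OF G] .
  have "v \<noteq> []" using N0[of N0] len_first_ev(1)[OF v(1)] unfolding v(2) by auto
  then obtain l u where "v = l # u" by (cases v) auto
  then have "first (M ** ev (word_power w N0)) = Some l"
    using len_first_ev(2)[OF v(1)] unfolding v(2) by simp
  then have "first (M ** ev (word_power w N)) = Some l" if "N \<ge> N0" for N
    using const[of "N - N0"] that by simp
  then show ?thesis unfolding eventually_sequentially by blast
qed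

text \<open>\<open>S\<close> moves to the right across the power of \<open>w\<close>, and from there
  it cannot affect the first letter of a long product.\<close>

lemma first_mult_commuting:
  assumes "reduced_word w" "w \<noteq> []" "hd w \<noteq> inv_letter (last w)" "M \<in> rot_group"
    and S: "S \<in> rot_group" "S ** ev w = ev w ** S"
  shows "eventually (\<lambda>N. first ((M ** S) ** ev (word_power w N)) = first (M ** ev (word_power w N)))
    sequentially"
proof -
  obtain s where s: "S = ev s" using S(1) by (auto simp: rot_group_def)
  have comm: "S ** ev (word_power w N) = ev (word_power w N) ** S" for N
  proof (induction N)
    case 0
    show ?case by (simp add: word_power_def)
  next
    case (Suc N)
    then show ?case unfolding ev_word_power_Suc by (metis S(2) matrix_mul_assoc)
  qed
  show ?thesis using len_mult_word_power[OF assms(1-4), of "length s"]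
  proof eventually_elim
    case (elim N)
    have "first ((M ** ev (word_power w N)) ** ev s) = first (M ** ev (word_power w N))"
      by (rule first_mult_ev) (use elim assms(4) in \<open>auto intro: rot_group_mult\<close>)
    then show ?case by (metis comm matrix_mul_assoc s)
  qed
qed

section \<open>Rotations about a common axis\<close>

unbundle cross3_syntax

text \<open>On the plane orthogonal to \<open>x\<close>, spanned by \<open>v\<close> and
  \<open>u\<close>, a rotation fixing \<open>x\<close> acts like multiplication by a complex number,
  and such multiplications commute.\<close>

lemma rotation_fixing_commute:
  fixes x :: "real^3"
  assumes R: "rotation_matrix R" "R *v x = x" and S: "rotation_matrix S" "S *v x = x" and "x \<noteq> 0"
  shows "R ** S = S ** R"
proof -
  obtain v where v: "v \<noteq> 0" "x \<bullet> v = 0"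
    using orthogonal_to_vector_exists[of x] by (auto simp: orthogonal_def)
  define u where "u = x \<times> v"
  define k where "k = u \<bullet> u"
  have "u \<noteq> 0" using v \<open>x \<noteq> 0\<close> norm_and_cross_eq_0 unfolding u_def by blast
  then have k: "k \<noteq> 0" by (simp add: k_def)
  \<comment> \<open>Expansion in the basis \<open>x\<close>, \<open>v\<close>, \<open>u\<close>
    through its reciprocal basis. The factor \<open>k\<close> is the triple product of the basis and
    saves normalising it.\<close>
  have expand: "k *\<^sub>R y = (y \<bullet> (v \<times> u)) *\<^sub>R x + (y \<bullet> (u \<times> x)) *\<^sub>R v + (y \<bullet> u) *\<^sub>R u" for y
  proof -
    have "(u \<bullet> (x \<times> v)) *\<^sub>R y = (y \<bullet> (v \<times> u)) *\<^sub>R x + (y \<bullet> (u \<times> x)) *\<^sub>R v + (y \<bullet> (x \<times> v)) *\<^sub>R u"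
      for u
      unfolding vec_eq_iff forall_3 by (simp add: cross3_def inner_vec_def sum_3 algebra_simps)
    from this[of u] show ?thesis by (simp add: k_def flip: u_def)
  qed
  have vu: "v \<times> u = (v \<bullet> v) *\<^sub>R x - (x \<bullet> v) *\<^sub>R v"
    unfolding u_def vec_eq_iff forall_3 by (simp add: cross3_def inner_vec_def sum_3 algebra_simps)
  \<comment> \<open>\<open>T\<close> commutes with the cross product by its fixed vector
    \<open>x\<close>, which takes \<open>v\<close> to \<open>u\<close>; so the same \<open>a\<close>
    and \<open>b\<close> describe both images.\<close>
  have plane: "\<exists>a b. k *\<^sub>R (T *v v) = a *\<^sub>R v + b *\<^sub>R u \<and> k *\<^sub>R (T *v u) = a *\<^sub>R u + b *\<^sub>R (x \<times> u)"
    if T: "rotation_matrix T" "T *v x = x" for T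
  proof -
    have "orthogonal_transformation ((*v) T)"
      using T(1) by (simp add: rotation_matrix_def orthogonal_transformation_matrix)
    then have "(T *v v) \<bullet> (T *v x) = v \<bullet> x" by (simp add: orthogonal_transformation_def)
    then have "(T *v v) \<bullet> x = 0" using T(2) v(2) by (simp add: inner_commute)
    then have "(T *v v) \<bullet> (v \<times> u) = 0" by (simp add: vu v(2))
    then obtain a b where ab: "k *\<^sub>R (T *v v) = a *\<^sub>R v + b *\<^sub>R u" using expand[of "T *v v"] by auto
    have "k *\<^sub>R (T *v u) = x \<times> (k *\<^sub>R (T *v v))"
      using cross_rotation_matrix[OF T(1), of x v] T(2) by (simp add: u_def cross_mult_right)
    then have "k *\<^sub>R (T *v u) = a *\<^sub>R u + b *\<^sub>R (x \<times> u)"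
      unfolding ab by (simp add: cross_add_right cross_mult_right u_def)
    with ab show ?thesis by blast
  qed
  obtain a b where ab: "k *\<^sub>R (R *v v) = a *\<^sub>R v + b *\<^sub>R u" "k *\<^sub>R (R *v u) = a *\<^sub>R u + b *\<^sub>R (x \<times> u)"
    using plane[OF R] by blast
  obtain c d where cd: "k *\<^sub>R (S *v v) = c *\<^sub>R v + d *\<^sub>R u" "k *\<^sub>R (S *v u) = c *\<^sub>R u + d *\<^sub>R (x \<times> u)"
    using plane[OF S] by blast
  \<comment> \<open>The resulting expression is symmetric under exchanging the pair
    \<open>a\<close>, \<open>b\<close> with the pair \<open>c\<close>, \<open>d\<close>.\<close>
  have "(k * k) *\<^sub>R ((R ** S) *v v) = k *\<^sub>R (R *v (k *\<^sub>R (S *v v)))"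
    by (simp add: matrix_vector_mult_scaleR flip: matrix_vector_mul_assoc)
  also have "\<dots> = c *\<^sub>R (k *\<^sub>R (R *v v)) + d *\<^sub>R (k *\<^sub>R (R *v u))"
    unfolding cd by (simp add: matrix_vector_mult_scaleR matrix_vector_right_distrib algebra_simps)
  also have "\<dots> = a *\<^sub>R (k *\<^sub>R (S *v v)) + b *\<^sub>R (k *\<^sub>R (S *v u))"
    unfolding ab cd by (simp add: algebra_simps)
  also have "\<dots> = k *\<^sub>R (S *v (k *\<^sub>R (R *v v)))"
    unfolding ab by (simp add: matrix_vector_mult_scaleR matrix_vector_right_distrib algebra_simps)
  also have "\<dots> = (k * k) *\<^sub>R ((S ** R) *v v)"
    by (simp add: matrix_vector_mult_scaleR flip: matrix_vector_mul_assoc)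
  finally have eq_v: "(R ** S) *v v = (S ** R) *v v" using k by simp
  have RS_u: "(T ** T') *v u = x \<times> ((T ** T') *v v)"
    if "rotation_matrix T" "T *v x = x" "rotation_matrix T'" "T' *v x = x" for T T'
    using cross_rotation_matrix[of "T ** T'" x v] that
    by (simp add: u_def rotation_matrix_mult flip: matrix_vector_mul_assoc)
  have eq_u: "(R ** S) *v u = (S ** R) *v u"
    using RS_u R S eq_v by simp
  have eq_x: "(R ** S) *v x = (S ** R) *v x"
    using R S by (simp flip: matrix_vector_mul_assoc)
  have "k *\<^sub>R ((R ** S) *v y) = k *\<^sub>R ((S ** R) *v y)" for y
  proof -
    have "k *\<^sub>R ((R ** S) *v y) = (R ** S) *v (k *\<^sub>R y)" by (simp add: matrix_vector_mult_scaleR)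
    also have "\<dots> = (S ** R) *v (k *\<^sub>R y)"
      unfolding expand[of y] matrix_vector_right_distrib matrix_vector_mult_scaleR eq_x eq_v eq_u ..
    finally show ?thesis by (simp add: matrix_vector_mult_scaleR)
  qed
  then show ?thesis using k by (simp add: matrix_eq)
qed

unbundle no cross3_syntax

section \<open>Equivariant choice of an end\<close>

lemma countable_rot_group: "countable rot_group"
  by (simp add: rot_group_def)

text \<open>Each nontrivial element fixes only a proper subspace, a null set, and countably many
  null sets cannot cover the open unit ball.\<close>

lemma exists_free_point:
  obtains p :: "real^3" where "p \<in> cball 0 1" "p \<noteq> 0"
    "\<And>M. M \<in> rot_group \<Longrightarrow> M *v p = p \<Longrightarrow> M = mat 1"
proof -
  define Fix where "Fix = (\<lambda>M :: real^3^3. {x. M *v x = x})"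
  define B where "B = (\<Union>M \<in> rot_group - {mat 1}. Fix M) \<union> {0}"
  have "negligible (Fix M)" if "M \<noteq> mat 1" for M
  proof -
    have "subspace (Fix M)" unfolding Fix_def
      by (auto simp: subspace_def matrix_vector_mult_scaleR matrix_vector_right_distrib)
    moreover have "Fix M \<noteq> UNIV" using that by (auto simp: Fix_def matrix_eq)
    ultimately have "dim (Fix M) < DIM(real^3)"
      by (metis dim_subset_UNIV dim_eq_full le_neq_implies_less span_eq_iff)
    then show ?thesis by (rule negligible_lowdim)
  qed
  moreover have "negligible {0 :: real^3}" by simp
  ultimately have "negligible B" unfolding B_def
    by (intro negligible_Un negligible_countable_Union) (auto simp: countable_rot_group)
  moreover have "\<not> negligible (ball (0 :: real^3) 1)"
    by (intro open_not_negligible) auto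
  ultimately obtain p where "p \<in> ball 0 1" "p \<notin> B"
    using negligible_subset by blast
  then show thesis by (intro that[of p]) (auto simp: B_def Fix_def)
qed

definition orbit :: "real^3 \<Rightarrow> (real^3) set" where
  "orbit x = (\<lambda>M. M *v x) ` rot_group"

lemma self_in_orbit: "x \<in> orbit x"
  using rot_group_ev[of "[]"] by (force simp: orbit_def)

lemma orbit_eq:
  assumes "y \<in> orbit x"
  shows "orbit y = orbit x"
proof -
  obtain M where M: "M \<in> rot_group" "y = M *v x" using assms by (auto simp: orbit_def)
  obtain N where N: "N \<in> rot_group" "N ** M = mat 1" using rot_group_inverse[OF M(1)] by metis
  have x: "x = N *v y" using N by (simp add: M matrix_vector_mul_assoc)
  have sub: "orbit a \<subseteq> orbit b" if "a = T *v b" "T \<in> rot_group" for a b T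
    using that by (auto simp: orbit_def matrix_vector_mul_assoc intro: rot_group_mult)
  show ?thesis using sub[OF M(2,1)] sub[OF x N(1)] by blast
qed

text \<open>\<open>c x\<close> stands for the first letter of the word attached to \<open>x\<close>.\<close>

definition equivariant_colouring ::
    "real^3 \<Rightarrow> (real^3) set \<Rightarrow> (real^3 \<Rightarrow> letter option) \<Rightarrow> bool" where
  "equivariant_colouring p X c \<longleftrightarrow> (\<forall>x\<in>X. (c x = None \<longleftrightarrow> x = p) \<and>
     (\<forall>l. c (gen l *v x) = Some l \<longleftrightarrow> c x \<noteq> Some (inv_letter l)))"

lemma rot_group_quotient:
  assumes "M \<in> rot_group" "N \<in> rot_group" "M *v x = N *v x"
  obtains S where "S \<in> rot_group" "S *v x = x" "N = M ** S"
proof -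
  obtain K where K: "K \<in> rot_group" "K ** M = mat 1" "M ** K = mat 1"
    using rot_group_inverse[OF assms(1)] .
  have "(K ** N) *v x = K *v (M *v x)" by (simp add: assms(3) matrix_vector_mul_assoc)
  then have "(K ** N) *v x = x" by (simp add: matrix_vector_mul_assoc K)
  moreover have "M ** (K ** N) = N" by (simp add: matrix_mul_assoc K)
  ultimately show thesis using that rot_group_mult K assms(2) by metis
qed

text \<open>\<open>M\<close> can be recovered from \<open>M *v p\<close>, so this point may be
  coloured by \<open>first M\<close>; the empty word, and with it \<open>None\<close>, occurs only
  at \<open>p\<close>.\<close>

lemma colouring_free_orbit:
  assumes free: "\<And>M. M \<in> rot_group \<Longrightarrow> M *v p = p \<Longrightarrow> M = mat 1"
  shows "\<exists>c. equivariant_colouring p (orbit p) c"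
proof -
  define c where "c = (\<lambda>x. first (THE M. M \<in> rot_group \<and> M *v p = x))"
  have c: "c (M *v p) = first M" if M: "M \<in> rot_group" for M
  proof -
    have "N = M" if "N \<in> rot_group" "N *v p = M *v p" for N
      using rot_group_quotient[OF M that(1) that(2)[symmetric]] free by (metis matrix_mul_rid)
    then have "(THE N. N \<in> rot_group \<and> N *v p = M *v p) = M"
      using M by (intro the_equality) auto
    then show ?thesis by (simp add: c_def)
  qed
  have "c (M *v p) = None \<longleftrightarrow> M *v p = p" if M: "M \<in> rot_group" for M
  proof -
    obtain w where w: "reduced_word w" "ev w = M" using rot_group_reduced[OF M] .
    have "first M = hd_opt w" using len_first_ev(2)[OF w(1)] w(2) by simp
    moreover have "first (mat 1) = None" using len_first_ev(2)[of "[]"] by simp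
    ultimately show ?thesis using c[OF M] free[OF M] w by (cases w) auto
  qed
  moreover have "c (gen l *v (M *v p)) = Some l \<longleftrightarrow> c (M *v p) \<noteq> Some (inv_letter l)"
    if M: "M \<in> rot_group" for M l
    using c[OF M] c[of "gen l ** M"] M first_gen_mult[OF M, of l]
    by (simp add: rot_group_mult matrix_vector_mul_assoc)
  ultimately have "equivariant_colouring p (orbit p) c"
    unfolding equivariant_colouring_def orbit_def by auto
  then show ?thesis by (intro exI[of _ c])
qed

text \<open>The end attached to \<open>M x\<close> is the limit of \<open>M w^N\<close>; it depends only on \<open>M x\<close> because \<open>w\<close>
  commutes with the stabilizer of \<open>x\<close>.\<close>

lemma colouring_by_end:
  assumes w: "reduced_word w" "w \<noteq> []" "hd w \<noteq> inv_letter (last w)"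
    and comm: "\<And>S. S \<in> rot_group \<Longrightarrow> S *v x = x \<Longrightarrow> S ** ev w = ev w ** S"
    and "p \<notin> orbit x"
  shows "\<exists>c. equivariant_colouring p (orbit x) c"
proof -
  define E where "E = (\<lambda>M. SOME l. eventually (\<lambda>N. first (M ** ev (word_power w N)) = Some l) sequentially)"
  have E: "eventually (\<lambda>N. first (M ** ev (word_power w N)) = Some (E M)) sequentially"
    if "M \<in> rot_group" for M
    unfolding E_def using first_mult_word_power_eventually_const[OF w that] by (rule someI_ex)
  have E_stab: "E (M ** S) = E M" if M: "M \<in> rot_group" and S: "S \<in> rot_group" "S *v x = x" for M S
  proof -
    \<comment> \<open>The claim does not mention \<open>N\<close>, so it is enough to obtain it for
      some large \<open>N\<close>.\<close>
    have "eventually (\<lambda>N. E (M ** S) = E M) sequentially"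
      using E[OF M] E[OF rot_group_mult[OF M S(1)]] first_mult_commuting[OF w M S(1) comm[OF S]]
      by eventually_elim simp
    then show ?thesis by simp
  qed
  \<comment> \<open>Two choices of \<open>M\<close> for the same \<open>y\<close> differ by a
    stabilizing factor on the right, which \<open>E_stab\<close> absorbs.\<close>
  define c where "c = (\<lambda>y. Some (E (SOME M. M \<in> rot_group \<and> M *v x = y)))"
  have c: "c (M *v x) = Some (E M)" if M: "M \<in> rot_group" for M
  proof -
    define N where "N = (SOME N. N \<in> rot_group \<and> N *v x = M *v x)"
    have "N \<in> rot_group \<and> N *v x = M *v x"
      unfolding N_def by (rule someI[of _ M]) (simp add: M)
    then obtain S where "S \<in> rot_group" "S *v x = x" "N = M ** S"
      using rot_group_quotient[OF M, of N x] by metis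
    then have "E N = E M" using E_stab M by simp
    then show ?thesis by (simp add: c_def flip: N_def)
  qed
  have "c (gen l *v (M *v x)) = Some l \<longleftrightarrow> c (M *v x) \<noteq> Some (inv_letter l)"
    if M: "M \<in> rot_group" for M l
  proof -
    have gM: "gen l ** M \<in> rot_group" using M by (simp add: rot_group_mult)
    have "eventually (\<lambda>N. E (gen l ** M) = l \<longleftrightarrow> E M \<noteq> inv_letter l) sequentially"
      using E[OF M] E[OF gM]
    proof eventually_elim
      case (elim N)
      then show ?case
        using first_gen_mult[of "M ** ev (word_power w N)" l] M
        by (simp add: rot_group_mult matrix_mul_assoc)
    qed
    then show ?thesis using c[OF M] c[OF gM] by (simp add: matrix_vector_mul_assoc)
  qed
  moreover have "c y \<noteq> None" for y by (simp add: c_def)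
  moreover have "M *v x \<noteq> p" if "M \<in> rot_group" for M
    using that assms(5) by (auto simp: orbit_def)
  ultimately show ?thesis unfolding equivariant_colouring_def orbit_def by blast
qed

text \<open>Take a shortest nonempty reduced word that fixes some point of the orbit. Were its first
  and last letters inverse, conjugation by the first would give a word shorter by two that fixes a
  point of the same orbit.\<close>

lemma exists_cyclically_reduced_stabilizer:
  assumes "S \<in> rot_group" "S \<noteq> mat 1" "S *v x = x"
  obtains y w where "y \<in> orbit x" "reduced_word w" "w \<noteq> []" "hd w \<noteq> inv_letter (last w)" "ev w *v y = y"
proof -
  define P where "P = (\<lambda>(y, w). y \<in> orbit x \<and> reduced_word w \<and> w \<noteq> [] \<and> ev w *v y = y)"
  obtain w0 where w0: "reduced_word w0" "ev w0 = S" using rot_group_reduced[OF assms(1)] .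
  have "P (x, w0)" using w0 assms by (auto simp: P_def self_in_orbit)
  then obtain yw where "P yw" and min: "\<And>zv. P zv \<Longrightarrow> length (snd yw) \<le> length (snd zv)"
    using ex_has_least_nat[of P "(x, w0)" "\<lambda>zv. length (snd zv)"] by blast
  then obtain y w where P: "P (y, w)" and min: "\<And>z v. P (z, v) \<Longrightarrow> length w \<le> length v"
    by (cases yw) force
  have yw: "y \<in> orbit x" "reduced_word w" "w \<noteq> []" "ev w *v y = y" using P by (auto simp: P_def)
  have "hd w \<noteq> inv_letter (last w)"
  proof
    assume h: "hd w = inv_letter (last w)"
    obtain l u where lu: "w = l # u" using yw(3) by (cases w) auto
    with h have "u \<noteq> []" by auto
    then obtain v where v: "w = l # v @ [inv_letter l]"
      using lu h by (metis append_butlast_last_id inv_letter_inv last_ConsR list.sel(1))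
    have "v \<noteq> []" using yw(2) v by auto
    define z where "z = gen (inv_letter l) *v y"
    have "z \<in> orbit y" by (auto simp: z_def orbit_def)
    then have "z \<in> orbit x" using orbit_eq[OF yw(1)] by simp
    moreover have "reduced_word v" using yw(2) v by (auto simp: successively_Cons successively_append_iff)
    moreover have "ev v *v z = z"
    proof -
      have "z = (gen (inv_letter l) ** ev w) *v y"
        using yw(4) by (simp add: z_def flip: matrix_vector_mul_assoc)
      also have "gen (inv_letter l) ** ev w = ev v ** gen (inv_letter l)"
        by (simp add: v ev_append matrix_mul_assoc)
      finally show ?thesis by (simp add: z_def flip: matrix_vector_mul_assoc)
    qed
    ultimately have "P (z, v)" using \<open>v \<noteq> []\<close> by (simp add: P_def)
    from min[OF this] show False by (simp add: v)
  qed
  with yw show thesis by (intro that)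
qed

lemma colouring_orbit:
  assumes "x \<noteq> 0" and free: "\<And>M. M \<in> rot_group \<Longrightarrow> M *v p = p \<Longrightarrow> M = mat 1"
  shows "\<exists>c. equivariant_colouring p (orbit x) c"
proof (cases "p \<in> orbit x")
  case True
  then show ?thesis using orbit_eq colouring_free_orbit[OF free] by metis
next
  case p: False
  show ?thesis
  proof (cases "\<exists>S \<in> rot_group. S \<noteq> mat 1 \<and> S *v x = x")
    case False
    \<comment> \<open>Only \<open>mat 1\<close> fixes \<open>x\<close> here and it commutes with
      everything, so any cyclically reduced word serves, for instance a single letter.\<close>
    then show ?thesis
      by (intro colouring_by_end[of "[(False, True)]"] p) auto
  next
    case True
    then obtain y w where w: "reduced_word w" "w \<noteq> []" "hd w \<noteq> inv_letter (last w)"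
        and y: "y \<in> orbit x" "ev w *v y = y"
      using exists_cyclically_reduced_stabilizer by metis
    have "y \<noteq> 0"
    proof
      assume "y = 0"
      have "x \<in> orbit y" using orbit_eq[OF y(1)] self_in_orbit by simp
      then show False using \<open>x \<noteq> 0\<close> \<open>y = 0\<close> by (auto simp: orbit_def)
    qed
    then have "S ** ev w = ev w ** S" if "S \<in> rot_group" "S *v y = y" for S
      using that y rotation_ev by (intro rotation_fixing_commute[of _ y]) (auto simp: rot_group_def)
    then have "\<exists>c. equivariant_colouring p (orbit y) c"
      using p orbit_eq[OF y(1)] by (intro colouring_by_end[OF w]) auto
    then show ?thesis using orbit_eq[OF y(1)] by simp
  qed
qed

text \<open>A colouring is chosen for each orbit as a set, so that all points of an orbit share it
  and equivariance survives the gluing.\<close>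

lemma exists_colouring:
  assumes "\<And>M. M \<in> rot_group \<Longrightarrow> M *v p = p \<Longrightarrow> M = mat 1"
  shows "\<exists>c. equivariant_colouring p (- {0}) c"
proof -
  have "\<forall>X \<in> orbit ` (- {0}). \<exists>c. equivariant_colouring p X c"
    using colouring_orbit[OF _ assms] by auto
  then obtain C where C: "\<And>x. x \<noteq> 0 \<Longrightarrow> equivariant_colouring p (orbit x) (C (orbit x))"
    by (metis (no_types) ComplI imageI singletonD)
  define c where "c = (\<lambda>x. C (orbit x) x)"
  have "orbit (gen l *v x) = orbit x" for l x
    by (rule orbit_eq) (auto simp: orbit_def)
  then have "equivariant_colouring p (- {0}) c"
    using C self_in_orbit unfolding equivariant_colouring_def c_def by auto
  then show ?thesis by blast
qed

section \<open>Equidecompositions of the ball\<close>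

lemma SE3_comp:
  assumes "f \<in> SE3" "g \<in> SE3"
  shows "f \<circ> g \<in> SE3"
proof -
  obtain R b S c where R: "rotation_matrix R" "f = (\<lambda>x. R *v x + b)"
    and S: "rotation_matrix S" "g = (\<lambda>x. S *v x + c)"
    using assms by (auto simp: SE3_def)
  have "f \<circ> g = (\<lambda>x. (R ** S) *v x + (R *v c + b))"
    by (auto simp: R S matrix_vector_right_distrib simp flip: matrix_vector_mul_assoc)
  then show ?thesis using rotation_matrix_mult[OF R(1) S(1)] by (auto simp: SE3_def)
qed

lemma SE3_rotation: "rotation_matrix R \<Longrightarrow> (\<lambda>x. R *v x) \<in> SE3"
  unfolding SE3_def by (intro CollectI exI[of _ R] exI[of _ 0]) simp

lemma SE3_translation: "(\<lambda>x. x + b) \<in> SE3"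
  unfolding SE3_def
  by (intro CollectI exI[of _ "mat 1"] exI[of _ b]) (simp add: rotation_matrix_mat_1)

lemma SE3_id: "(\<lambda>x. x) \<in> SE3"
  using SE3_translation[of 0] by simp

text \<open>The pieces are carried along by \<open>f\<close>, and each motion is preceded by
  \<open>g\<close>, which undoes \<open>f\<close>.\<close>

lemma equidecomposable_image:
  assumes "equidecomposable r A B" and g: "g \<in> SE3" "\<And>x. g (f x) = x"
  shows "equidecomposable r (f ` A) B"
proof -
  obtain E \<gamma> where E: "disjoint_union_of r E A" "\<forall>i<r. \<gamma> i \<in> SE3"
    "disjoint_union_of r (\<lambda>i. \<gamma> i ` E i) B"
    using assms(1) unfolding equidecomposable_def by blast
  have "inj f" using g(2) by (metis injI)
  then have "disjoint_union_of r (\<lambda>i. f ` E i) (f ` A)"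
    using E(1) unfolding disjoint_union_of_def disjoint_family_on_def
    by (auto simp: image_UN simp flip: image_Int)
  moreover have "disjoint_union_of r (\<lambda>i. (\<gamma> i \<circ> g) ` f ` E i) B"
    using E(3) by (simp add: image_image g(2))
  moreover have "\<forall>i<r. \<gamma> i \<circ> g \<in> SE3" using E(2) g(1) SE3_comp by blast
  ultimately show ?thesis unfolding equidecomposable_def
    by (intro exI[of _ "\<lambda>i. f ` E i"] exI[of _ "\<lambda>i. \<gamma> i \<circ> g"] conjI)
qed

lemma equidecomposable_2:
  assumes "A0 \<inter> A1 = {}" "g0 \<in> SE3" "g1 \<in> SE3" "g0 ` A0 \<inter> g1 ` A1 = {}"
  shows "equidecomposable 2 (A0 \<union> A1) (g0 ` A0 \<union> g1 ` A1)"
  unfolding equidecomposable_def disjoint_union_of_def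
  by (intro exI[of _ "\<lambda>i. [A0, A1] ! i"] exI[of _ "\<lambda>i. [g0, g1] ! i"])
     (use assms in \<open>auto simp: numeral_2_eq_2 lessThan_Suc less_Suc_eq disjoint_family_on_def\<close>)

lemma equidecomposable_3:
  assumes "A0 \<inter> A1 = {}" "A0 \<inter> A2 = {}" "A1 \<inter> A2 = {}" "g0 \<in> SE3" "g1 \<in> SE3" "g2 \<in> SE3"
    "g0 ` A0 \<inter> g1 ` A1 = {}" "g0 ` A0 \<inter> g2 ` A2 = {}" "g1 ` A1 \<inter> g2 ` A2 = {}"
  shows "equidecomposable 3 (A0 \<union> A1 \<union> A2) (g0 ` A0 \<union> g1 ` A1 \<union> g2 ` A2)"
  unfolding equidecomposable_def disjoint_union_of_def
  by (intro exI[of _ "\<lambda>i. [A0, A1, A2] ! i"] exI[of _ "\<lambda>i. [g0, g1, g2] ! i"])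
     (use assms in \<open>auto simp: numeral_3_eq_3 lessThan_Suc less_Suc_eq disjoint_family_on_def\<close>)

text \<open>The images of \<open>C\<close> under the iterates of \<open>f\<close> decrease, and the
  difference of two consecutive ones is an iterated image of the first difference; what is left
  after \<open>m\<close> steps is the last piece.\<close>

lemma disjoint_union_of_iterates:
  assumes "inj f" "f ` C \<subseteq> C"
  shows "disjoint_union_of (Suc m)
    (\<lambda>j. if j < m then (f ^^ j) ` (C - f ` C) else (f ^^ m) ` C) C"
proof -
  have inj: "inj (f ^^ j)" for j using assms(1) by (rule inj_fn)
  have peel: "(f ^^ j) ` (C - f ` C) = (f ^^ j) ` C - (f ^^ Suc j) ` C" for j
    using inj by (simp add: image_set_diff funpow_swap1 image_image)
  have step: "(f ^^ Suc j) ` C \<subseteq> (f ^^ j) ` C" for j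
    using image_mono[OF assms(2), of "f ^^ j"] by (simp add: funpow_swap1 image_image)
  have mono: "(f ^^ j) ` C \<subseteq> (f ^^ i) ` C" if "i \<le> j" for i j
    by (rule lift_Suc_antimono_le[of "\<lambda>j. (f ^^ j) ` C", OF step that])
  define P where "P = (\<lambda>j. if j < m then (f ^^ j) ` (C - f ` C) else (f ^^ m) ` C)"
  have disj: "P i \<inter> P j = {}" if "i < j" "j < Suc m" for i j
  proof -
    have "P i = (f ^^ i) ` C - (f ^^ Suc i) ` C" using that by (simp add: P_def peel)
    moreover have "P j \<subseteq> (f ^^ j) ` C" using that by (cases "j < m") (auto simp: P_def less_Suc_eq)
    moreover have "(f ^^ j) ` C \<subseteq> (f ^^ Suc i) ` C" using that by (intro mono) simp
    ultimately show ?thesis by blast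
  qed
  have "(\<Union>i<k. (f ^^ i) ` (C - f ` C)) \<union> (f ^^ k) ` C = C" for k
  proof (induction k)
    case (Suc k)
    have "(\<Union>i<Suc k. (f ^^ i) ` (C - f ` C)) \<union> (f ^^ Suc k) ` C =
      (\<Union>i<k. (f ^^ i) ` (C - f ` C)) \<union> ((f ^^ k) ` (C - f ` C) \<union> (f ^^ Suc k) ` C)"
      by (simp only: lessThan_Suc UN_insert Un_ac)
    also have "(f ^^ k) ` (C - f ` C) \<union> (f ^^ Suc k) ` C = (f ^^ k) ` C"
      using step[of k] unfolding peel by blast
    finally show ?case using Suc by simp
  qed simp
  moreover have "(\<Union>i<Suc m. P i) = (\<Union>i<m. (f ^^ i) ` (C - f ` C)) \<union> (f ^^ m) ` C"
    by (auto simp: P_def lessThan_Suc)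
  ultimately have "(\<Union>i<Suc m. P i) = C" by simp
  moreover have "disjoint_family_on P {..<Suc m}"
    unfolding disjoint_family_on_def using disj by (metis Int_commute lessThan_iff nat_neq_iff)
  ultimately show ?thesis unfolding disjoint_union_of_def P_def by blast
qed

text \<open>This puts the part of the ball outside \<open>C\<close>, including the centre, into the
  last piece without adding an index.\<close>

lemma disjoint_union_of_enlarge_last:
  assumes "disjoint_union_of (Suc m) P A" "A \<inter> B = {}"
  shows "disjoint_union_of (Suc m) (P(m := P m \<union> B)) (A \<union> B)"
proof -
  have U: "(\<Union>i<Suc m. P i) = A" and D: "disjoint_family_on P {..<Suc m}"
    using assms(1) by (auto simp: disjoint_union_of_def)
  then have "P i \<inter> B = {}" if "i < Suc m" for i using assms(2) that by blast
  with D have "disjoint_family_on (P(m := P m \<union> B)) {..<Suc m}"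
    unfolding disjoint_family_on_def by (auto; blast)
  moreover have "(\<Union>i<Suc m. (P(m := P m \<union> B)) i) = A \<union> B"
    unfolding U[symmetric] by (auto simp: lessThan_Suc)
  ultimately show ?thesis by (simp add: disjoint_union_of_def)
qed

section \<open>Assembling the paradoxical decomposition of the ball\<close>

theorem theorem5p5:
  fixes n :: nat
  assumes "n \<ge> 2"
  shows "paradoxical n (3 * n - 1) (cball (0 :: real^3) 1)"
proof -
  obtain p :: "real^3" where p: "p \<in> cball 0 1" "p \<noteq> 0"
    and free: "\<And>M. M \<in> rot_group \<Longrightarrow> M *v p = p \<Longrightarrow> M = mat 1"
    using exists_free_point by metis
  obtain c where c: "equivariant_colouring p (- {0}) c" using exists_colouring[OF free] by blast
  define D where "D = cball (0 :: real^3) 1 - {0}"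
  define rot where "rot = (\<lambda>l (x :: real^3). gen l *v x)"
  have rot_inv [simp]: "rot l (rot (inv_letter l) x) = x" "rot (inv_letter l) (rot l x) = x" for l x
    by (simp_all add: rot_def matrix_vector_mul_assoc)
  have rot_SE3: "rot l \<in> SE3" for l
    unfolding rot_def by (intro SE3_rotation rotation_gen)
  have norm_rot: "norm (rot l x) = norm x" for l x
    using rotation_gen[of l] orthogonal_transformation_norm[of "rot l"]
    by (simp add: rot_def[abs_def] rotation_matrix_def orthogonal_transformation_matrix)
  have rot_D: "rot l x \<in> D \<longleftrightarrow> x \<in> D" for l x
    using norm_rot[of l x] norm_eq_zero[of x] norm_eq_zero[of "rot l x"] by (simp add: D_def)
  have rot_image: "rot l ` X = {x. rot (inv_letter l) x \<in> X}" for l X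
    by (auto simp: image_iff) (metis rot_inv(1))
  have c_None: "c x = None \<longleftrightarrow> x = p" if "x \<in> D" for x
    using c that by (auto simp: equivariant_colouring_def D_def)
  have c_rot: "c (rot l x) = Some l \<longleftrightarrow> c x \<noteq> Some (inv_letter l)" if "x \<in> D" for x l
    using c that unfolding equivariant_colouring_def D_def rot_def by (simp del: split_paired_All)
  define K where "K = (\<lambda>l. {x \<in> D. c x = Some l})"
  \<comment> \<open>A point of \<open>D\<close> lies in the image iff rotating it back gives colour
    \<open>Some (inv_letter l)\<close>; by equivariance this means that its own colour is not
    \<open>Some l\<close>.\<close>
  have rot_K: "rot l ` K (inv_letter l) = D - K l" for l
    using c_rot[of _ "inv_letter l"] by (auto simp: rot_image K_def rot_D)
  define a b where "a = (False, True)" and "b = (True, True)"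
  define a' b' where "a' = inv_letter a" and "b' = inv_letter b"
  have letters: "l = a \<or> l = a' \<or> l = b \<or> l = b'" for l :: letter
    by (cases l) (auto simp: a_def b_def a'_def b'_def)
  have "a \<noteq> a'" by (simp add: a'_def)
  have rot_Ka: "rot a ` K a' = D - K a" and rot_Kb: "rot b ` K b' = D - K b"
    using rot_K[of a] rot_K[of b] by (simp_all add: a'_def b'_def)
  define f where "f = rot b"
  have inj_f: "inj f" unfolding f_def by (metis injI rot_inv(2))
  define C where "C = D - K b'"
  have "f ` D = D" unfolding f_def by (auto simp: rot_image rot_D)
  then have fn_D: "(f ^^ j) ` D = D" for j
    by (induction j) (simp, metis funpow.simps(2) image_comp)
  have fC: "f ` C = K b"
  proof -
    have "f ` C = D - (D - K b)"
      unfolding C_def using inj_f \<open>f ` D = D\<close> rot_Kb by (simp add: image_set_diff f_def)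
    then show ?thesis by (auto simp: K_def)
  qed
  have fC_sub: "f ` C \<subseteq> C" unfolding fC by (auto simp: C_def K_def b'_def)
  define Q where "Q = C - f ` C"
  \<comment> \<open>\<open>p\<close> is the only point of \<open>D\<close> with colour
    \<open>None\<close>, hence the only one outside the four sets \<open>K l\<close>.\<close>
  have Q: "Q = K a \<union> K a' \<union> {p}"
  proof -
    have "x \<in> Q \<longleftrightarrow> x \<in> D \<and> c x \<noteq> Some b \<and> c x \<noteq> Some b'" for x
      unfolding Q_def fC by (auto simp: C_def K_def)
    moreover have "c x \<noteq> Some b \<and> c x \<noteq> Some b' \<longleftrightarrow> c x = Some a \<or> c x = Some a' \<or> x = p"
      if "x \<in> D" for x
      using c_None[OF that] letters[of "the (c x)"]
      by (cases "c x") (auto simp: a_def b_def a'_def b'_def)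
    moreover have "p \<in> D" using p by (simp add: D_def)
    ultimately show ?thesis by (auto simp: K_def)
  qed
  have ball: "cball 0 1 = D \<union> {0}" by (auto simp: D_def)
  \<comment> \<open>Keeping \<open>K a\<close> and rotating \<open>K a'\<close> fills
    \<open>D\<close>; the missing centre is supplied by \<open>p\<close>, translated by
    \<open>- p\<close>.\<close>
  have Q3: "equidecomposable 3 Q (cball 0 1)"
  proof -
    have "p \<in> D" using p by (simp add: D_def)
    then have "p \<notin> K l" for l using c_None[of p] by (auto simp: K_def)
    moreover have "K a \<inter> K a' = {}" using \<open>a \<noteq> a'\<close> by (auto simp: K_def)
    moreover have "0 \<notin> D" by (simp add: D_def)
    ultimately have "equidecomposable 3 (K a \<union> K a' \<union> {p})
        ((\<lambda>x. x) ` K a \<union> rot a ` K a' \<union> (\<lambda>x. x + - p) ` {p})"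
      using rot_Ka
      by (intro equidecomposable_3 SE3_id rot_SE3 SE3_translation) (auto simp: K_def)
    moreover have "(\<lambda>x. x) ` K a \<union> rot a ` K a' \<union> (\<lambda>x. x + - p) ` {p} = cball 0 1"
      unfolding rot_Ka ball by (auto simp: K_def)
    ultimately show ?thesis by (simp only: Q)
  qed
  define g where "g = rot b'"
  have gf: "(g ^^ j) ((f ^^ j) x) = x" for j x
  proof (induction j)
    case (Suc j)
    have "(g ^^ Suc j) ((f ^^ Suc j) x) = (g ^^ j) (g (f ((f ^^ j) x)))" by (simp add: funpow_swap1)
    with Suc show ?case by (simp add: f_def g_def b'_def)
  qed simp
  have funpow_SE3: "h ^^ j \<in> SE3" if "h \<in> SE3" for h j
    using that SE3_id by (induction j) (auto intro: SE3_comp simp: id_def)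
  have Qj: "equidecomposable 3 ((f ^^ j) ` Q) (cball 0 1)" for j
    by (rule equidecomposable_image[OF Q3, of "g ^^ j"]) (simp_all add: funpow_SE3 g_def rot_SE3 gf[unfolded g_def])
  obtain m where n: "n = Suc m" and "m \<ge> 1" using assms by (cases n) auto
  \<comment> \<open>Indices below \<open>m\<close> hold the rotated copies of \<open>Q\<close>;
    index \<open>m\<close> holds the rest of the ball.\<close>
  define P where "P = (\<lambda>j. if j < m then (f ^^ j) ` Q else (f ^^ m) ` C)(m := (f ^^ m) ` C \<union> (K b' \<union> {0}))"
  have C_disj: "C \<inter> (K b' \<union> {0}) = {}" by (auto simp: C_def D_def)
  have "disjoint_union_of n P (C \<union> (K b' \<union> {0}))"
    using disjoint_union_of_enlarge_last[OF disjoint_union_of_iterates[OF inj_f fC_sub, of m] C_disj]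
    unfolding P_def n Q_def by simp
  moreover have "C \<union> (K b' \<union> {0}) = cball 0 1" by (auto simp: C_def K_def D_def)
  ultimately have P: "disjoint_union_of n P (cball 0 1)" by simp
  \<comment> \<open>Hence \<open>f ^^ m\<close> moves \<open>K b'\<close> onto the part of
    \<open>D\<close> missed by the image of \<open>C\<close>, while that image and the centre stay
    in place: two pieces suffice.\<close>
  have fn_C: "(f ^^ m) ` C = D - (f ^^ m) ` K b'"
    unfolding C_def using inj_fn[OF inj_f] by (simp add: image_set_diff fn_D)
  have last: "equidecomposable 2 (P m) (cball 0 1)"
  proof -
    have "(f ^^ m) ` K b' \<subseteq> (f ^^ m) ` D" by (rule image_mono) (auto simp: K_def)
    then have sub: "(f ^^ m) ` K b' \<subseteq> D" by (simp add: fn_D)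
    have "(f ^^ m) ` C \<subseteq> f ` C"
    proof -
      obtain k where m: "m = Suc k" using \<open>m \<ge> 1\<close> by (cases m) auto
      have "(f ^^ k) ` C \<subseteq> C" using fC_sub by (induction k) (auto simp: image_subset_iff)
      then show ?thesis unfolding m by (metis funpow.simps(2) image_comp image_mono)
    qed
    then have "(f ^^ m) ` C \<inter> K b' = {}" unfolding fC by (auto simp: K_def b'_def)
    moreover have "0 \<notin> D" by (simp add: D_def)
    ultimately have "equidecomposable 2 (((f ^^ m) ` C \<union> {0}) \<union> K b')
        ((\<lambda>x. x) ` ((f ^^ m) ` C \<union> {0}) \<union> (f ^^ m) ` K b')"
      using sub fn_C rot_SE3
      by (intro equidecomposable_2 SE3_id funpow_SE3) (auto simp: K_def f_def)
    moreover have "(\<lambda>x. x) ` ((f ^^ m) ` C \<union> {0}) \<union> (f ^^ m) ` K b' = cball 0 1"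
      unfolding fn_C ball using sub by auto
    moreover have "((f ^^ m) ` C \<union> {0}) \<union> K b' = P m" by (auto simp: P_def)
    ultimately show ?thesis by simp
  qed
  have "\<forall>j<n. equidecomposable (if j < m then 3 else 2) (P j) (cball 0 1)"
    using Qj last by (auto simp: P_def n less_Suc_eq)
  \<comment> \<open>Three pieces for each of \<open>m\<close> sets and two for the last: 3 m + 2 = 3
    (m + 1) - 1.\<close>
  moreover have "(\<Sum>j<n. if j < m then 3 else 2) = 3 * n - (1 :: nat)" by (simp add: n)
  ultimately show ?thesis
    unfolding paradoxical_def using P
    by (intro exI[of _ P] exI[of _ "\<lambda>j. if j < m then 3 else 2"] conjI)
qed

end
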